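(* There exists a sequence $(B_k)_{k\ge 0}$ of positive numbers such that, for every $k\ge 0$ and each $\lambda>B_k$, the boundary value problem $$-u''(t)-\frac{n-1}{t}u'(t)=g(u(t))-\lambda-f(t),\qquad u'(0)=0,\quad u(1)=0,$$ with $u$ having a local minimum at $0$, has no solution $u\in\partial Z_{2k}(\lambda)$ satisfying $u'(0)\le 0$.
   Context: Let $n\ge 1$ be an integer (the ODE describes radial solutions, on the unit ball of $\mathbf{R}^n$, of $-\Delta u=g(u)-\lambda-f$ with $u=0$ on the boundary). The parameter $\lambda>0$ is real, and $f\in C^1([0,1],\mathbf{R})$. The function $g\in C(\mathbf{R},\mathbf{R})$ is such that there exists $A>0$ for which $g_+=g|_{[A,\infty[}$ is positive, increasing, differentiable and convex, and $g_-=g|_{]-\infty,-A]}$ is positive, convex and decreasing. In addition $g(x)/x\to+\infty$ as $x\to+\infty$ and $g(x)/x\to-\infty$ as $x\to-\infty$. Here $g_+^{-1}$ denotes the inverse function of $g_+$, defined on $[g(A),\infty[$. Let $E=\{u\in C^1([0,1],\mathbf{R}): u'(0)\le 0,\ u(1)=0\}$ with the $C^1$ topology. For an integer $k\ge 0$ and $\lambda>A$ (with $\lambda$ large enough that $g_+^{-1}(\lambda+f(t))$ is defined for all $t\in[0,1]$), let $$Z_k(\lambda)=\{u\in E:\ u(t)-g_+^{-1}(\lambda+f(t))\text{ has } k \text{ simple zeros in } [0,1]\},$$ meaning that this function has exactly $k$ zeros in $[0,1]$ and all of them are simple (its derivative does not vanish at them). $\partial Z_{2k}(\lambda)$ denotes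 the boundary of $Z_{2k}(\lambda)$ in $E$. The numbers $B_k$ are understood to be large enough that $Z_{2k}(\lambda)$ is defined for $\lambda>B_k$. *)

theory Defs
  imports "HOL-Analysis.Analysis"
begin

text \<open>One-sided derivative at the end points 0 and 1.\<close>

definition D01 :: "(real \<Rightarrow> real) \<Rightarrow> real \<Rightarrow> real" where
  "D01 u t = vector_derivative u (at t within {0..1})"

definition C1_on01 :: "(real \<Rightarrow> real) \<Rightarrow> bool" where
  "C1_on01 u \<longleftrightarrow> u differentiable_on {0..1} \<and> continuous_on {0..1} (D01 u)"

text \<open>The elements of \<open>C1_space\<close> are extensional, so that two functions with the same values
  on the unit interval are equal and the distance below separates points.\<close>

definition C1_space :: "(real \<Rightarrow> real) set" where
  "C1_space = {u \<in> extensional {0..1}. C1_on01 u}"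

text \<open>The value 0 outside the carrier is only there because the library's metric spaces require
  nonnegativity of the distance at all arguments.\<close>

definition C1_dist :: "(real \<Rightarrow> real) \<Rightarrow> (real \<Rightarrow> real) \<Rightarrow> real" where
  "C1_dist u v = (if u \<in> C1_space \<and> v \<in> C1_space
     then (SUP t\<in>{0..1}. \<bar>u t - v t\<bar>) + (SUP t\<in>{0..1}. \<bar>D01 u t - D01 v t\<bar>) else 0)"

lemma bdd_above_abs_diff01:
  fixes u v :: "real \<Rightarrow> real"
  assumes "continuous_on {0..1} u" "continuous_on {0..1} v"
  shows "bdd_above ((\<lambda>t. \<bar>u t - v t\<bar>) ` {0..1})"
  by (intro bounded_imp_bdd_above compact_imp_bounded compact_continuous_image
      continuous_intros assms) auto

lemma SUP_abs_diff01_nonneg: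
  fixes u v :: "real \<Rightarrow> real"
  assumes "continuous_on {0..1} u" "continuous_on {0..1} v"
  shows "0 \<le> (SUP t\<in>{0..1}. \<bar>u t - v t\<bar>)"
  by (rule cSUP_upper2[OF bdd_above_abs_diff01[OF assms], of 0]) auto

lemma SUP_abs_diff01_triangle:
  fixes u v w :: "real \<Rightarrow> real"
  assumes "continuous_on {0..1} u" "continuous_on {0..1} v" "continuous_on {0..1} w"
  shows "(SUP t\<in>{0..1}. \<bar>u t - w t\<bar>) \<le> (SUP t\<in>{0..1}. \<bar>u t - v t\<bar>) + (SUP t\<in>{0..1}. \<bar>v t - w t\<bar>)"
proof (rule cSUP_least)
  fix t :: real assume t: "t \<in> {0..1}"
  show "\<bar>u t - w t\<bar> \<le> (SUP t\<in>{0..1}. \<bar>u t - v t\<bar>) + (SUP t\<in>{0..1}. \<bar>v t - w t\<bar>)"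
    using cSUP_upper[OF t bdd_above_abs_diff01[OF assms(1,2)]]
      cSUP_upper[OF t bdd_above_abs_diff01[OF assms(2,3)]] by linarith
qed auto

lemma C1_spaceD:
  assumes "u \<in> C1_space"
  shows "continuous_on {0..1} u" "continuous_on {0..1} (D01 u)" "u \<in> extensional {0..1}"
  using assms differentiable_imp_continuous_on by (auto simp: C1_space_def C1_on01_def)

lemma Metric_space_C1: "Metric_space C1_space C1_dist"
proof
  fix u v :: "real \<Rightarrow> real"
  show "0 \<le> C1_dist u v"
    by (auto simp: C1_dist_def intro!: add_nonneg_nonneg SUP_abs_diff01_nonneg C1_spaceD)
  show "C1_dist u v = C1_dist v u"
    by (auto simp: C1_dist_def abs_minus_commute)
next
  fix u v assume u: "u \<in> C1_space" and v: "v \<in> C1_space"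
  show "C1_dist u v = 0 \<longleftrightarrow> u = v"
  proof
    assume "C1_dist u v = 0"
    then have "(SUP t\<in>{0..1}. \<bar>u t - v t\<bar>) = 0"
      using SUP_abs_diff01_nonneg[OF C1_spaceD(1)[OF u] C1_spaceD(1)[OF v]]
        SUP_abs_diff01_nonneg[OF C1_spaceD(2)[OF u] C1_spaceD(2)[OF v]] u v
      by (simp add: C1_dist_def)
    then have "u t = v t" if "t \<in> {0..1}" for t
      using cSUP_upper[OF that bdd_above_abs_diff01[OF C1_spaceD(1)[OF u] C1_spaceD(1)[OF v]]]
      by simp
    then show "u = v"
      using C1_spaceD(3)[OF u] C1_spaceD(3)[OF v] by (rule extensionalityI[rotated 2])
  qed (use u in \<open>simp add: C1_dist_def\<close>)
next
  fix u v w assume uvw: "u \<in> C1_space" "v \<in> C1_space" "w \<in> C1_space"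
  show "C1_dist u w \<le> C1_dist u v + C1_dist v w"
    using SUP_abs_diff01_triangle[OF uvw[THEN C1_spaceD(1)]]
      SUP_abs_diff01_triangle[OF uvw[THEN C1_spaceD(2)]] uvw
    by (simp add: C1_dist_def)
qed

definition C1_top :: "(real \<Rightarrow> real) topology" where
  "C1_top = Metric_space.mtopology C1_space C1_dist"

definition E_set :: "(real \<Rightarrow> real) set" where
  "E_set = {u \<in> C1_space. D01 u 0 \<le> 0 \<and> u 1 = 0}"

definition E_top :: "(real \<Rightarrow> real) topology" where
  "E_top = subtopology C1_top E_set"

definition has_simple_zeros :: "nat \<Rightarrow> (real \<Rightarrow> real) \<Rightarrow> bool" where
  "has_simple_zeros k w \<longleftrightarrow>
     finite {t \<in> {0..1}. w t = 0} \<and> card {t \<in> {0..1}. w t = 0} = k \<and>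
     (\<forall>t\<in>{0..1}. w t = 0 \<longrightarrow>
        (\<exists>d. d \<noteq> 0 \<and> (w has_real_derivative d) (at t within {0..1})))"

definition g_plus_inv :: "(real \<Rightarrow> real) \<Rightarrow> real \<Rightarrow> real \<Rightarrow> real" where
  "g_plus_inv g A = the_inv_into {A..} g"

definition Z_set ::
  "(real \<Rightarrow> real) \<Rightarrow> (real \<Rightarrow> real) \<Rightarrow> real \<Rightarrow> nat \<Rightarrow> real \<Rightarrow> (real \<Rightarrow> real) set" where
  "Z_set g f A k lam = {u \<in> E_set. has_simple_zeros k (\<lambda>t. u t - g_plus_inv g A (lam + f t))}"

text \<open>The values of \<open>Z_set\<close> are meaningful only if this holds, since \<open>g_plus_inv g A\<close> is
  unspecified outside the range of \<open>g\<close> on \<open>{A..}\<close>.\<close>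

definition Z_defined :: "(real \<Rightarrow> real) \<Rightarrow> (real \<Rightarrow> real) \<Rightarrow> real \<Rightarrow> real \<Rightarrow> bool" where
  "Z_defined g f A lam \<longleftrightarrow> A < lam \<and> (\<forall>t\<in>{0..1}. g A \<le> lam + f t)"

text \<open>The equation is singular at 0, so it is required on the half-open interval only; there
  \<open>u'\<close> is differentiable, and \<open>u\<close> is \<open>C\<^sup>1\<close> up to 0.\<close>

definition solves_bvp ::
  "nat \<Rightarrow> (real \<Rightarrow> real) \<Rightarrow> (real \<Rightarrow> real) \<Rightarrow> real \<Rightarrow> (real \<Rightarrow> real) \<Rightarrow> bool" where
  "solves_bvp n g f lam u \<longleftrightarrow> C1_on01 u \<and>
     (\<forall>t\<in>{0<..1}. D01 u differentiable (at t within {0..1}) \<and>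
        - D01 (D01 u) t - (real n - 1) / t * D01 u t = g (u t) - lam - f t) \<and>
     D01 u 0 = 0 \<and> u 1 = 0"

definition local_min_at_0 :: "(real \<Rightarrow> real) \<Rightarrow> bool" where
  "local_min_at_0 u \<longleftrightarrow> (\<forall>\<^sub>F t in at 0 within {0..1}. u 0 \<le> u t)"

end

theory Submission
  imports Defs
begin

text \<open>Write \<open>\<phi> t = g_plus_inv g A (lam + f t)\<close> for the curve of positive equilibria. The zeros of
  \<open>u - \<phi>\<close> are stable under small \<open>C\<^sup>1\<close>-perturbations as long as they are simple and do not sit at an
  end point (\<open>simple_zero_count_locally_constant\<close>). So an element \<open>u\<close> of the frontier of \<open>Z_set\<close>
  touches \<open>\<phi>\<close> at some \<open>\<tau>\<close> in a special way: either \<open>\<tau> = 0\<close>, or the two graphs are tangent at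
  \<open>\<tau>\<close> (\<open>frontier_simple_zeros_contact\<close>).

  In both cases a solution is almost at rest at an equilibrium: its value is \<open>x0 = \<phi> \<tau>\<close>, and its
  slope is 0 or \<open>\<phi>' \<tau> = f' \<tau> / g' x0\<close>, which is at most \<open>sup \<bar>f'\<bar>\<close> for large \<open>lam\<close>. Its energy
  \<open>u'\<^sup>2 / 2 + G u - (lam + f) u\<close>, where \<open>G\<close> is the primitive of \<open>g\<close> vanishing at 0, is then near the
  bottom of a potential well of depth \<open>g x0 * x0 - G x0\<close>. On the other hand \<open>u 1 = 0\<close> requires the
  energy to be nonnegative at the first zero of \<open>u\<close> after \<open>\<tau>\<close>. The friction term only decreases the
  energy, and the dependence of \<open>f\<close> on \<open>t\<close> can raise it by an amount of order \<open>x0\<close> at most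
  (\<open>solution_energy_bound_at_contact\<close>). Since \<open>g\<close> is superlinear, the depth of the well is of larger
  order than \<open>x0\<close>, and \<open>x0\<close> tends to infinity with \<open>lam\<close>; so the solution cannot escape once
  \<open>lam\<close> is large. The bound on \<open>lam\<close> found in this way is the same for all \<open>k\<close>.\<close>

section \<open>Stability of the number of simple zeros\<close>

lemma mean_value_unit_interval:
  fixes w w' :: "real \<Rightarrow> real"
  assumes w: "\<And>t. t \<in> {0..1} \<Longrightarrow> (w has_real_derivative w' t) (at t within {0..1})"
    and ab: "0 \<le> a" "a < b" "b \<le> 1"
  shows "\<exists>x\<in>{a<..<b}. w b - w a = w' x * (b - a)"
proof (rule mvt_simple[OF \<open>a < b\<close>])
  fix x assume "a \<le> x" "x \<le> b"
  then have "(w has_real_derivative w' x) (at x within {a..b})"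
    using ab by (intro DERIV_subset[OF w]) auto
  then show "(w has_derivative (*) (w' x)) (at x within {a..b})"
    by (simp add: has_field_derivative_def)
qed

text \<open>Near a zero where \<open>w'\<close> is large and nearly constant, \<open>w\<close> has reached the size
  \<open>\<mu> * \<rho>\<close>, with opposite signs, at distance \<open>\<rho>\<close> on either side. A perturbation smaller than
  this keeps both signs, and the intermediate value theorem applies.\<close>

lemma transversal_zero_persists:
  fixes w w' v :: "real \<Rightarrow> real"
  assumes w: "\<And>t. t \<in> {0..1} \<Longrightarrow> (w has_real_derivative w' t) (at t within {0..1})"
    and mod: "\<And>t. t \<in> {0..1} \<Longrightarrow> \<bar>t - z\<bar> \<le> \<rho> \<Longrightarrow> \<bar>w' t - w' z\<bar> \<le> \<mu>"
    and z: "w z = 0" "2 * \<mu> \<le> \<bar>w' z\<bar>" and pos: "0 < \<mu>" "0 < \<rho>"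
    and inside: "0 \<le> z - \<rho>" "z + \<rho> \<le> 1"
    and v: "continuous_on {0..1} v" "\<And>t. t \<in> {0..1} \<Longrightarrow> \<bar>v t - w t\<bar> < \<mu> * \<rho>"
  shows "\<exists>t\<in>{0..1}. \<bar>t - z\<bar> \<le> \<rho> \<and> v t = 0"
proof -
  have mvt: "\<exists>x\<in>{a<..<b}. w b - w a = w' x * (b - a)" if "0 \<le> a" "a < b" "b \<le> 1" for a b
    using w that by (rule mean_value_unit_interval)
  obtain x where x: "x \<in> {z<..<z + \<rho>}" "w (z + \<rho>) = w' x * \<rho>"
    using mvt[of z "z + \<rho>"] inside pos z by auto
  obtain y where y: "y \<in> {z - \<rho><..<z}" "w (z - \<rho>) = - (w' y * \<rho>)"
    using mvt[of "z - \<rho>" z] inside pos z by fastforce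
  have wx: "\<bar>w' x - w' z\<bar> \<le> \<mu>" and wy: "\<bar>w' y - w' z\<bar> \<le> \<mu>"
    using x y inside by (auto intro!: mod)
  have v2: "\<bar>v (z + \<rho>) - w (z + \<rho>)\<bar> < \<mu> * \<rho>" "\<bar>v (z - \<rho>) - w (z - \<rho>)\<bar> < \<mu> * \<rho>"
    using inside pos by (auto intro!: v(2))
  have cont: "continuous_on {z - \<rho>..z + \<rho>} v"
    using inside by (intro continuous_on_subset[OF v(1)]) auto
  have "\<exists>t. z - \<rho> \<le> t \<and> t \<le> z + \<rho> \<and> v t = 0"
  proof (cases "w' z > 0")
    case True
    then have "\<mu> * \<rho> \<le> w' x * \<rho>" "\<mu> * \<rho> \<le> w' y * \<rho>"
      using wx wy z pos by (auto intro!: mult_right_mono)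
    then show ?thesis
      using x y v2 pos by (intro IVT' cont) linarith+
  next
    case False
    then have "w' x \<le> - \<mu>" "w' y \<le> - \<mu>" using wx wy z pos by linarith+
    then have "w' x * \<rho> \<le> - \<mu> * \<rho>" "w' y * \<rho> \<le> - \<mu> * \<rho>"
      using pos mult_right_mono[of "w' x" "- \<mu>" \<rho>] mult_right_mono[of "w' y" "- \<mu>" \<rho>] by auto
    then show ?thesis
      using x y v2 pos by (intro IVT2' cont) linarith+
  qed
  then obtain t where "z - \<rho> \<le> t" "t \<le> z + \<rho>" "v t = 0" by blast
  then show ?thesis
    using inside by (intro bexI[of _ t]) auto
qed

text \<open>By Rolle's theorem \<open>w'\<close> would vanish between two zeros closer than \<open>\<delta>\<close>, where it still
  has to be close to its large value at either of them.\<close>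

lemma transversal_zeros_separated:
  fixes w w' :: "real \<Rightarrow> real"
  assumes w: "\<And>t. t \<in> {0..1} \<Longrightarrow> (w has_real_derivative w' t) (at t within {0..1})"
    and mod: "\<And>s t. s \<in> {0..1} \<Longrightarrow> t \<in> {0..1} \<Longrightarrow> \<bar>s - t\<bar> \<le> \<delta> \<Longrightarrow> \<bar>w' s - w' t\<bar> \<le> \<mu>"
    and big: "\<And>t. t \<in> {0..1} \<Longrightarrow> w t = 0 \<Longrightarrow> 2 * \<mu> \<le> \<bar>w' t\<bar>" and pos: "0 < \<mu>"
    and ab: "a \<in> {0..1}" "b \<in> {0..1}" "w a = 0" "w b = 0" "\<bar>a - b\<bar> \<le> \<delta>"
  shows "a = b"
proof -
  have False if ab: "a \<in> {0..1}" "b \<in> {0..1}" "w a = 0" "w b = 0" "b - a \<le> \<delta>" "a < b" for a b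
  proof -
    have "\<exists>x\<in>{a<..<b}. w b - w a = w' x * (b - a)"
      by (rule mean_value_unit_interval[OF w]) (use ab in auto)
    then obtain x where "x \<in> {a<..<b}" "w' x * (b - a) = 0" using ab by auto
    then have "x \<in> {a<..<b}" "w' x = 0" by auto
    then show False using mod[of x a] big[of a] that pos by auto
  qed
  from this[of a b] this[of b a] show ?thesis using ab by fastforce
qed

text \<open>Sending each zero of \<open>w\<close> to a zero of \<open>v\<close> at distance at most \<open>\<delta> / 2\<close> is injective,
  because the zeros of \<open>w\<close> are more than \<open>\<delta>\<close> apart. The hypotheses on \<open>w\<close> are quantitative so that
  they survive a perturbation: then the lemma can be used a second time with the two functions
  exchanged, which turns the inequality into an equality.\<close>

lemma zeros_card_le_of_perturbation:
  fixes w w' v :: "real \<Rightarrow> real"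
  assumes w: "\<And>t. t \<in> {0..1} \<Longrightarrow> (w has_real_derivative w' t) (at t within {0..1})"
    and mod: "\<And>s t. s \<in> {0..1} \<Longrightarrow> t \<in> {0..1} \<Longrightarrow> \<bar>s - t\<bar> \<le> \<delta> \<Longrightarrow> \<bar>w' s - w' t\<bar> \<le> \<mu>"
    and big: "\<And>t. t \<in> {0..1} \<Longrightarrow> w t = 0 \<Longrightarrow> 2 * \<mu> \<le> \<bar>w' t\<bar>" and pos: "0 < \<mu>" "0 < \<delta>"
    and inside: "\<And>t. t \<in> {0..1} \<Longrightarrow> w t = 0 \<Longrightarrow> \<delta> \<le> t \<and> t \<le> 1 - \<delta>"
    and v: "continuous_on {0..1} v" "\<And>t. t \<in> {0..1} \<Longrightarrow> \<bar>v t - w t\<bar> < \<mu> * (\<delta> / 2)"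
    and fin: "finite {t \<in> {0..1}. v t = 0}"
  shows "card {t \<in> {0..1}. w t = 0} \<le> card {t \<in> {0..1}. v t = 0}"
proof -
  have "\<exists>s\<in>{0..1}. \<bar>s - t\<bar> \<le> \<delta> / 2 \<and> v s = 0" if "t \<in> {0..1}" "w t = 0" for t
    using mod that big inside[OF that] pos
    by (intro transversal_zero_persists[OF w _ _ _ _ _ _ _ v(1) v(2)]) auto
  then obtain \<eta> where \<eta>: "\<And>t. t \<in> {0..1} \<Longrightarrow> w t = 0 \<Longrightarrow> \<eta> t \<in> {0..1} \<and> \<bar>\<eta> t - t\<bar> \<le> \<delta> / 2 \<and> v (\<eta> t) = 0"
    by metis
  have "inj_on \<eta> {t \<in> {0..1}. w t = 0}"
  proof (rule inj_onI)
    fix a b assume ab: "a \<in> {t \<in> {0..1}. w t = 0}" "b \<in> {t \<in> {0..1}. w t = 0}" "\<eta> a = \<eta> b"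
    then have "\<bar>\<eta> b - a\<bar> \<le> \<delta> / 2" "\<bar>\<eta> b - b\<bar> \<le> \<delta> / 2"
      using \<eta>[of a] \<eta>[of b] by auto
    then have "\<bar>a - b\<bar> \<le> \<delta>" by linarith
    show "a = b"
      by (rule transversal_zeros_separated[of w w' \<delta> \<mu>])
        (use w mod big pos(1) ab \<open>\<bar>a - b\<bar> \<le> \<delta>\<close> in \<open>simp_all only: mem_Collect_eq\<close>)
  qed
  then show ?thesis
    by (rule card_inj_on_le) (use \<eta> fin in auto)
qed

lemma finite_separated_in_unit_interval:
  fixes S :: "real set"
  assumes "S \<subseteq> {0..1}" "0 < \<delta>" "\<And>a b. a \<in> S \<Longrightarrow> b \<in> S \<Longrightarrow> \<bar>a - b\<bar> \<le> \<delta> \<Longrightarrow> a = b"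
  shows "finite S"
proof (rule inj_on_finite)
  show "inj_on (\<lambda>t. \<lfloor>t / \<delta>\<rfloor>) S"
  proof (rule inj_onI)
    fix a b assume ab: "a \<in> S" "b \<in> S" "\<lfloor>a / \<delta>\<rfloor> = \<lfloor>b / \<delta>\<rfloor>"
    then have "\<bar>a / \<delta> - b / \<delta>\<bar> \<le> 1" by linarith
    then have "\<bar>a - b\<bar> \<le> \<delta>" using assms(2)
      by (simp add: diff_divide_distrib[symmetric] abs_divide)
    then show "a = b" using ab assms(3) by blast
  qed
  show "(\<lambda>t. \<lfloor>t / \<delta>\<rfloor>) ` S \<subseteq> {0..\<lfloor>1 / \<delta>\<rfloor>}"
  proof (rule image_subsetI)
    fix t assume "t \<in> S"
    then have "0 \<le> t" "t \<le> 1" using assms(1) by auto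
    then show "\<lfloor>t / \<delta>\<rfloor> \<in> {0..\<lfloor>1 / \<delta>\<rfloor>}"
      using assms(2) by (simp add: floor_mono divide_right_mono)
  qed
qed simp

text \<open>Simplicity of the zeros gives a positive lower bound for \<open>\<bar>w\<bar> + \<bar>w'\<bar>\<close> by compactness, and this
  bound is stable under \<open>C\<^sup>1\<close>-perturbations. The end points must not be zeros: a simple zero at an
  end point can leave the interval under an arbitrarily small perturbation.\<close>

lemma simple_zero_count_locally_constant:
  fixes w w' :: "real \<Rightarrow> real"
  assumes w: "\<And>t. t \<in> {0..1} \<Longrightarrow> (w has_real_derivative w' t) (at t within {0..1})"
    and cont: "continuous_on {0..1} w'"
    and ends: "w 0 \<noteq> 0" "w 1 \<noteq> 0"
    and simple: "\<And>t. t \<in> {0..1} \<Longrightarrow> w t = 0 \<Longrightarrow> w' t \<noteq> 0"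
  obtains r m where "0 < r"
    "\<And>v v'. \<lbrakk>\<And>t. t \<in> {0..1} \<Longrightarrow> (v has_real_derivative v' t) (at t within {0..1});
       \<And>t. t \<in> {0..1} \<Longrightarrow> \<bar>v t - w t\<bar> < r \<and> \<bar>v' t - w' t\<bar> < r\<rbrakk> \<Longrightarrow> has_simple_zeros m v"
proof -
  have contw: "continuous_on {0..1} w"
    by (rule DERIV_continuous_on) (rule w)
  have "\<exists>x\<in>{0..1}. \<forall>y\<in>{0..1}. \<bar>w x\<bar> + \<bar>w' x\<bar> \<le> \<bar>w y\<bar> + \<bar>w' y\<bar>"
    by (intro continuous_attains_inf continuous_intros contw cont) auto
  then obtain x where x: "x \<in> {0..1}" "\<And>y. y \<in> {0..1} \<Longrightarrow> \<bar>w x\<bar> + \<bar>w' x\<bar> \<le> \<bar>w y\<bar> + \<bar>w' y\<bar>"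
    by blast
  \<comment> \<open>With a ninth of the minimum, \<open>\<bar>w\<bar> < \<mu>\<close> forces \<open>\<bar>w'\<bar> > 8 \<mu>\<close>, and a perturbation by \<open>\<mu>\<close>
    leaves \<open>\<bar>v'\<bar> > 6 \<mu>\<close> at the zeros of \<open>v\<close>, while the oscillation of \<open>v'\<close> stays below \<open>3 \<mu>\<close>.\<close>
  define \<mu> where "\<mu> = (\<bar>w x\<bar> + \<bar>w' x\<bar>) / 9"
  have \<mu>: "0 < \<mu>" using simple[OF x(1)] by (cases "w x = 0") (auto simp: \<mu>_def)
  have low: "9 * \<mu> \<le> \<bar>w t\<bar> + \<bar>w' t\<bar>" if "t \<in> {0..1}" for t
    using x(2)[OF that] by (simp add: \<mu>_def)
  define e where "e = min \<bar>w 0\<bar> \<bar>w 1\<bar> / 2"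
  have e: "0 < e" using ends by (simp add: e_def)
  obtain d1 where d1: "d1 > 0" "\<And>s t. s \<in> {0..1} \<Longrightarrow> t \<in> {0..1} \<Longrightarrow> dist s t < d1 \<Longrightarrow> dist (w' s) (w' t) < \<mu>"
    using compact_uniformly_continuous[OF cont] \<mu> unfolding uniformly_continuous_on_def
    by (metis compact_Icc)
  obtain d2 where d2: "d2 > 0" "\<And>s t. s \<in> {0..1} \<Longrightarrow> t \<in> {0..1} \<Longrightarrow> dist s t < d2 \<Longrightarrow> dist (w s) (w t) < e"
    using compact_uniformly_continuous[OF contw] e unfolding uniformly_continuous_on_def
    by (metis compact_Icc)
  define \<delta> where "\<delta> = min (min d1 d2) 1 / 2"
  have \<delta>: "0 < \<delta>" "\<delta> < d1" "\<delta> < d2" "\<delta> < 1" using d1 d2 by (auto simp: \<delta>_def)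
  define r where "r = min (min \<mu> e) (3 * \<mu> * (\<delta> / 2))"
  have r: "0 < r" "r \<le> \<mu>" "r \<le> e" "r \<le> 3 * \<mu> * (\<delta> / 2)" using \<mu> e \<delta> by (auto simp: r_def)
  define near where "near v v' \<longleftrightarrow> (\<forall>t\<in>{0..1}. \<bar>v t - w t\<bar> < r \<and> \<bar>v' t - w' t\<bar> < r)" for v v'
  \<comment> \<open>Every function in the neighbourhood, \<open>w\<close> included, satisfies the same quantitative bounds.\<close>
  have modulus: "\<bar>v' s - v' t\<bar> \<le> 3 * \<mu>"
    if "near v v'" and st: "s \<in> {0..1}" "t \<in> {0..1}" "\<bar>s - t\<bar> \<le> \<delta>" for v v' s t
  proof -
    have "\<bar>w' s - w' t\<bar> < \<mu>" using d1(2)[of s t] st \<delta> by (auto simp: dist_real_def)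
    moreover have "\<bar>v' s - w' s\<bar> < r" "\<bar>v' t - w' t\<bar> < r"
      using that(1) bspec[OF _ st(1)] bspec[OF _ st(2)] unfolding near_def by blast+
    ultimately show ?thesis using r by linarith
  qed
  have steep: "2 * (3 * \<mu>) \<le> \<bar>v' t\<bar>"
    and inside: "\<delta> \<le> t \<and> t \<le> 1 - \<delta>"
    if "near v v'" and t: "t \<in> {0..1}" "v t = 0" for v v' t
  proof -
    have v: "\<bar>v t - w t\<bar> < r" "\<bar>v' t - w' t\<bar> < r"
      using that(1) bspec[OF _ t(1)] unfolding near_def by blast+
    show "2 * (3 * \<mu>) \<le> \<bar>v' t\<bar>" using v low[OF t(1)] t(2) r by linarith
    have wt: "\<bar>w t\<bar> < e" using v t(2) r by linarith
    show "\<delta> \<le> t \<and> t \<le> 1 - \<delta>"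
    proof (rule ccontr)
      assume "\<not> ?thesis"
      then have "\<bar>w t - w 0\<bar> < e \<or> \<bar>w t - w 1\<bar> < e"
        using d2(2)[of t 0] d2(2)[of t 1] t \<delta> by (auto simp: dist_real_def)
      then show False using wt unfolding e_def by linarith
    qed
  qed
  have finite: "finite {t \<in> {0..1}. v t = 0}"
    if dv: "\<And>t. t \<in> {0..1} \<Longrightarrow> (v has_real_derivative v' t) (at t within {0..1})"
    and v: "near v v'" for v v'
  proof (rule finite_separated_in_unit_interval[OF _ \<delta>(1)])
    fix a b assume ab: "a \<in> {t \<in> {0..1}. v t = 0}" "b \<in> {t \<in> {0..1}. v t = 0}" "\<bar>a - b\<bar> \<le> \<delta>"
    show "a = b"
    proof (rule transversal_zeros_separated[of v v' \<delta> "3 * \<mu>"])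
      show "(v has_real_derivative v' t) (at t within {0..1})" if "t \<in> {0..1}" for t
        using that by (rule dv)
      show "\<bar>v' s - v' t\<bar> \<le> 3 * \<mu>" if "s \<in> {0..1}" "t \<in> {0..1}" "\<bar>s - t\<bar> \<le> \<delta>" for s t
        using v that by (rule modulus)
      show "2 * (3 * \<mu>) \<le> \<bar>v' t\<bar>" if "t \<in> {0..1}" "v t = 0" for t
        using v that by (rule steep)
    qed (use ab \<mu> in auto)
  qed auto
  have card_le: "card {t \<in> {0..1}. v t = 0} \<le> card {t \<in> {0..1}. h t = 0}"
    if dv: "\<And>t. t \<in> {0..1} \<Longrightarrow> (v has_real_derivative v' t) (at t within {0..1})"
    and v: "near v v'"
    and h: "continuous_on {0..1} h" "finite {t \<in> {0..1}. h t = 0}"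
    and vh: "\<And>t. t \<in> {0..1} \<Longrightarrow> \<bar>h t - v t\<bar> < r" for v v' h
  proof (rule zeros_card_le_of_perturbation[of v v' \<delta> "3 * \<mu>"])
    show "(v has_real_derivative v' t) (at t within {0..1})" if "t \<in> {0..1}" for t
      using that by (rule dv)
    show "\<bar>v' s - v' t\<bar> \<le> 3 * \<mu>" if "s \<in> {0..1}" "t \<in> {0..1}" "\<bar>s - t\<bar> \<le> \<delta>" for s t
      using v that by (rule modulus)
    show "2 * (3 * \<mu>) \<le> \<bar>v' t\<bar>" if "t \<in> {0..1}" "v t = 0" for t
      using v that by (rule steep)
    show "\<delta> \<le> t \<and> t \<le> 1 - \<delta>" if "t \<in> {0..1}" "v t = 0" for t
      using v that by (rule inside)
    show "\<bar>h t - v t\<bar> < 3 * \<mu> * (\<delta> / 2)" if "t \<in> {0..1}" for t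
      using vh[OF that] r(4) by (rule less_le_trans)
  qed (use \<mu> \<delta> h in auto)
  have ww: "near w w'" using r by (simp add: near_def)
  define m where "m = card {t \<in> {0..1}. w t = 0}"
  show thesis
  proof (rule that[OF r(1), of m])
    fix v v'
    assume dv: "\<And>t. t \<in> {0..1} \<Longrightarrow> (v has_real_derivative v' t) (at t within {0..1})"
      and vw: "\<And>t. t \<in> {0..1} \<Longrightarrow> \<bar>v t - w t\<bar> < r \<and> \<bar>v' t - w' t\<bar> < r"
    have contv: "continuous_on {0..1} v"
      by (rule DERIV_continuous_on) (rule dv)
    have v: "near v v'" using vw by (simp add: near_def)
    have fv: "finite {t \<in> {0..1}. v t = 0}" using dv v by (rule finite)
    have fw: "finite {t \<in> {0..1}. w t = 0}" using w ww by (rule finite)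
    have "m \<le> card {t \<in> {0..1}. v t = 0}" unfolding m_def
      using w ww contv fv by (rule card_le) (use vw in auto)
    moreover have "card {t \<in> {0..1}. v t = 0} \<le> m" unfolding m_def
      using dv v contw fw by (rule card_le) (use vw in \<open>auto simp: abs_minus_commute\<close>)
    moreover have "\<exists>d. d \<noteq> 0 \<and> (v has_real_derivative d) (at t within {0..1})"
      if "t \<in> {0..1}" "v t = 0" for t
      using steep[OF v that] dv[OF that(1)] \<mu> by (intro exI[of _ "v' t"]) auto
    ultimately show "has_simple_zeros m v"
      using fv by (auto simp: has_simple_zeros_def)
  qed
qed

section \<open>Frontier points touch the comparison curve\<close>

lemma C1_on01_has_real_derivative:
  assumes "C1_on01 u" "t \<in> {0..1}"
  shows "(u has_real_derivative D01 u t) (at t within {0..1})"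
  using assms unfolding C1_on01_def D01_def differentiable_on_def
  by (simp add: has_real_derivative_iff_has_vector_derivative vector_derivative_works[symmetric])

lemma C1_on01_has_real_derivative_at:
  assumes "C1_on01 u" "0 < t" "t < 1"
  shows "(u has_real_derivative D01 u t) (at t)"
  using C1_on01_has_real_derivative[OF assms(1), of t] assms(2,3)
  by (simp add: at_within_Icc_at)

lemma C1_dist_less_imp_close:
  assumes u: "u \<in> C1_space" and v: "v \<in> C1_space" and d: "C1_dist u v < r" and t: "t \<in> {0..1}"
  shows "\<bar>v t - u t\<bar> < r" "\<bar>D01 v t - D01 u t\<bar> < r"
proof -
  note cu = C1_spaceD(1,2)[OF u] and cv = C1_spaceD(1,2)[OF v]
  have "(SUP t\<in>{0..1}. \<bar>u t - v t\<bar>) + (SUP t\<in>{0..1}. \<bar>D01 u t - D01 v t\<bar>) < r"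
    using d u v by (simp add: C1_dist_def)
  moreover have "\<bar>u t - v t\<bar> \<le> (SUP t\<in>{0..1}. \<bar>u t - v t\<bar>)"
    by (rule cSUP_upper[OF t bdd_above_abs_diff01[OF cu(1) cv(1)]])
  moreover have "\<bar>D01 u t - D01 v t\<bar> \<le> (SUP t\<in>{0..1}. \<bar>D01 u t - D01 v t\<bar>)"
    by (rule cSUP_upper[OF t bdd_above_abs_diff01[OF cu(2) cv(2)]])
  ultimately show "\<bar>v t - u t\<bar> < r" "\<bar>D01 v t - D01 u t\<bar> < r" by linarith+
qed

lemma has_simple_zeros_unique:
  "has_simple_zeros k w \<Longrightarrow> has_simple_zeros m w \<Longrightarrow> k = m"
  by (simp add: has_simple_zeros_def)

text \<open>If \<open>u\<close> has neither a contact at 0 nor a tangential one, then the number of simple zeros is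
  constant in a \<open>C\<^sup>1\<close>-neighbourhood \<open>U\<close> of \<open>u\<close>. This neighbourhood meets the set, so the number is
  \<open>k\<close>, and \<open>U\<close> lies in the set; but then \<open>u\<close> is an interior point. The contact at 0 has to be
  admitted, since a zero there can be pushed out of the interval; at 1 the boundary condition
  and \<open>\<phi> 1 \<noteq> 0\<close> exclude it.\<close>

lemma frontier_simple_zeros_contact:
  fixes \<phi> \<phi>' :: "real \<Rightarrow> real"
  assumes \<phi>: "\<And>t. t \<in> {0..1} \<Longrightarrow> (\<phi> has_real_derivative \<phi>' t) (at t within {0..1})"
    and cont: "continuous_on {0..1} \<phi>'" and end1: "\<phi> 1 \<noteq> 0"
    and u: "u \<in> E_top frontier_of {u \<in> E_set. has_simple_zeros k (\<lambda>t. u t - \<phi> t)}"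
  obtains \<tau> where "\<tau> \<in> {0..1}" "u \<tau> = \<phi> \<tau>" "\<tau> = 0 \<or> D01 u \<tau> = \<phi>' \<tau>"
proof (rule ccontr)
  assume no: "\<not> thesis"
  note contact = that
  define Z where "Z = {u \<in> E_set. has_simple_zeros k (\<lambda>t. u t - \<phi> t)}"
  interpret Metric_space C1_space C1_dist by (rule Metric_space_C1)
  have cl: "u \<in> E_top closure_of Z" and int: "u \<notin> E_top interior_of Z"
    using u by (auto simp: frontier_of_def Z_def)
  have uE: "u \<in> E_set"
    using cl by (auto simp: in_closure_of E_top_def)
  have C1: "C1_on01 v" if "v \<in> E_set" for v
    using that by (simp add: E_set_def C1_space_def)
  have deriv: "((\<lambda>t. v t - \<phi> t) has_real_derivative D01 v t - \<phi>' t) (at t within {0..1})"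
    if "v \<in> E_set" "t \<in> {0..1}" for v t
    using C1_on01_has_real_derivative[OF C1[OF that(1)] that(2)] \<phi>[OF that(2)]
    by (rule DERIV_diff)
  obtain r m where r: "0 < r" and stable:
    "\<And>v v'. \<lbrakk>\<And>t. t \<in> {0..1} \<Longrightarrow> (v has_real_derivative v' t) (at t within {0..1});
       \<And>t. t \<in> {0..1} \<Longrightarrow> \<bar>v t - (u t - \<phi> t)\<bar> < r \<and> \<bar>v' t - (D01 u t - \<phi>' t)\<bar> < r\<rbrakk>
      \<Longrightarrow> has_simple_zeros m v"
  proof (rule simple_zero_count_locally_constant[of "\<lambda>t. u t - \<phi> t" "\<lambda>t. D01 u t - \<phi>' t"])
    show "continuous_on {0..1} (\<lambda>t. D01 u t - \<phi>' t)"
      using C1[OF uE] cont by (auto simp: C1_on01_def intro: continuous_on_diff)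
    show "u 0 - \<phi> 0 \<noteq> 0" using no contact[of 0] by auto
    show "u 1 - \<phi> 1 \<noteq> 0" using uE end1 by (simp add: E_set_def)
    show "D01 u t - \<phi>' t \<noteq> 0" if "t \<in> {0..1}" "u t - \<phi> t = 0" for t
      using no contact[of t] that by auto
  qed (use deriv[OF uE] in blast)+
  define U where "U = mball u r \<inter> E_set"
  have U: "openin E_top U" "u \<in> U"
    using r uE by (auto simp: E_top_def C1_top_def U_def E_set_def intro: openin_subtopology_Int)
  have count: "has_simple_zeros m (\<lambda>t. v t - \<phi> t)" if v: "v \<in> U" for v
  proof (rule stable[of _ "\<lambda>t. D01 v t - \<phi>' t"])
    fix t :: real assume t: "t \<in> {0..1}"
    show "((\<lambda>t. v t - \<phi> t) has_real_derivative D01 v t - \<phi>' t) (at t within {0..1})"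
      using v t by (intro deriv) (auto simp: U_def)
    have "\<bar>v t - u t\<bar> < r" "\<bar>D01 v t - D01 u t\<bar> < r"
      using v t by (auto simp: U_def intro!: C1_dist_less_imp_close[of u v])
    then show "\<bar>v t - \<phi> t - (u t - \<phi> t)\<bar> < r \<and> \<bar>D01 v t - \<phi>' t - (D01 u t - \<phi>' t)\<bar> < r"
      by simp
  qed
  obtain v where "v \<in> U" "v \<in> Z" using cl U by (auto simp: in_closure_of)
  then have "m = k" using count[of v] by (auto simp: Z_def intro: has_simple_zeros_unique)
  then have "U \<subseteq> Z" using count by (auto simp: Z_def U_def)
  then have "u \<in> E_top interior_of Z" using U by (auto simp: interior_of_def)
  with int show False by simp
qed

section \<open>Energy of a solution\<close>

lemma integral_from_0_has_real_derivative:
  fixes g :: "real \<Rightarrow> real"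
  assumes "continuous_on UNIV g" "0 < x"
  shows "((\<lambda>y. integral {0..y} g) has_real_derivative g x) (at x)"
proof -
  have "((\<lambda>y. integral {0..y} g) has_real_derivative g x) (at x within {0..x + 1})"
    using assms by (intro integral_has_real_derivative continuous_on_subset[OF assms(1)]) auto
  then show ?thesis using assms(2) by (simp add: at_within_Icc_at)
qed

lemma integral_above_tangent:
  fixes g :: "real \<Rightarrow> real"
  assumes g: "continuous_on UNIV g" and a: "0 < a" "a \<le> b"
    and above: "\<And>x. a \<le> x \<Longrightarrow> g a + s * (x - a) \<le> g x"
  shows "integral {0..a} g + g a * (b - a) + s / 2 * (b - a)\<^sup>2 \<le> integral {0..b} g"
proof -
  define h where "h x = integral {0..x} g - g a * (x - a) - s / 2 * (x - a)\<^sup>2" for x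
  have "h a \<le> h b"
  proof (rule DERIV_nonneg_imp_nondecreasing[OF a(2)])
    fix x assume x: "a \<le> x" "x \<le> b"
    have "(h has_real_derivative (g x - g a - s * (x - a))) (at x)"
      unfolding h_def using x a
      by (auto intro!: derivative_eq_intros integral_from_0_has_real_derivative[OF g])
    then show "\<exists>y. (h has_real_derivative y) (at x) \<and> 0 \<le> y"
      using above[OF x(1)] by (intro exI conjI) auto
  qed
  then show ?thesis by (simp add: h_def)
qed

lemma integral_le_of_increasing:
  fixes g :: "real \<Rightarrow> real"
  assumes g: "continuous_on UNIV g" and a: "0 < a" "a \<le> b"
    and mono: "\<And>x. a \<le> x \<Longrightarrow> x \<le> b \<Longrightarrow> g x \<le> g b"
  shows "integral {0..b} g \<le> integral {0..a} g + g b * (b - a)"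
proof -
  define h where "h x = integral {0..x} g - g b * x" for x
  have "h b \<le> h a"
  proof (rule DERIV_nonpos_imp_nonincreasing[OF a(2)])
    fix x assume x: "a \<le> x" "x \<le> b"
    have "(h has_real_derivative (g x - g b)) (at x)"
      unfolding h_def using x a
      by (auto intro!: derivative_eq_intros integral_from_0_has_real_derivative[OF g])
    then show "\<exists>y. (h has_real_derivative y) (at x) \<and> y \<le> 0"
      using mono[OF x] by (intro exI conjI) auto
  qed
  then show ?thesis by (simp add: h_def algebra_simps)
qed

lemma first_zero_after:
  fixes u :: "real \<Rightarrow> real"
  assumes "continuous_on {a..b} u" "a \<le> b" "0 < u a" "u b = 0"
  obtains T where "a < T" "T \<le> b" "u T = 0" "\<And>t. a \<le> t \<Longrightarrow> t < T \<Longrightarrow> 0 < u t"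
proof -
  have "closed ({a..b} \<inter> u -` {0})"
    using assms by (intro continuous_closed_preimage) auto
  then have "compact ({a..b} \<inter> u -` {0})"
    by (metis Int_assoc inf.idem compact_Icc compact_Int_closed)
  moreover have "b \<in> {a..b} \<inter> u -` {0}" using assms by auto
  ultimately obtain T where T: "T \<in> {a..b} \<inter> u -` {0}" "\<And>t. t \<in> {a..b} \<inter> u -` {0} \<Longrightarrow> T \<le> t"
    using compact_attains_inf by (metis empty_iff)
  have "a \<noteq> T" using T(1) assms(3) by auto
  moreover have "0 < u t" if t: "a \<le> t" "t < T" for t
  proof (rule ccontr)
    assume "\<not> 0 < u t"
    then have "\<exists>s. a \<le> s \<and> s \<le> t \<and> u s = 0"
      using assms t T(1) by (intro IVT2') (auto intro: continuous_on_subset)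
    then obtain s where "a \<le> s" "s \<le> t" "u s = 0" by blast
    then show False using T(2)[of s] t T(1) by auto
  qed
  ultimately show ?thesis using that[of T] T(1) by auto
qed

text \<open>Let \<open>x0 = u \<tau>\<close>. The energy \<open>H = u'\<^sup>2 / 2 + G u - (lam + f) u\<close>, where \<open>G\<close> is the primitive of
  \<open>g\<close> vanishing at 0, is nonnegative where \<open>u\<close> vanishes, and the boundary condition forces \<open>u\<close> to
  vanish after \<open>\<tau>\<close>. At \<open>\<tau>\<close> the energy is about \<open>G x0 - g x0 * x0\<close>, the bottom of the potential well.
  Hence \<open>H\<close> has to climb by the depth of the well; but \<open>H' \<le> F * u\<close> until the first zero, so the climb
  is at most \<open>F * max u\<close>, and the tangent bound on \<open>g\<close> keeps \<open>u\<close> below \<open>2 * x0\<close>. The conclusion says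
  that the well cannot be deeper than the climb.\<close>

lemma solution_energy_bound_at_contact:
  fixes f g u :: "real \<Rightarrow> real"
  assumes n: "n \<ge> 1" and f: "C1_on01 f" and g: "continuous_on UNIV g"
    and sol: "solves_bvp n g f lam u"
    and F: "\<And>t. t \<in> {0..1} \<Longrightarrow> \<bar>D01 f t\<bar> \<le> F"
    and \<tau>: "\<tau> \<in> {0..1}" and contact: "g (u \<tau>) = lam + f \<tau>" and flat: "\<bar>D01 u \<tau>\<bar> \<le> F"
    and u\<tau>: "1 \<le> u \<tau>"
    and above: "\<And>x. u \<tau> \<le> x \<Longrightarrow> g (u \<tau>) + s * (x - u \<tau>) \<le> g x"
    and s: "F\<^sup>2 + 8 * F < s"
  shows "g (u \<tau>) * u \<tau> - integral {0..u \<tau>} g \<le> F\<^sup>2 / 2 + 2 * F * u \<tau>"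
proof -
  define x0 where "x0 = u \<tau>"
  define G where "G x = integral {0..x} g" for x
  define p where "p = D01 u"
  have C1u: "C1_on01 u" and u1: "u 1 = 0" using sol by (auto simp: solves_bvp_def)
  have F0: "0 \<le> F" using F[of 0] by simp
  have contu: "continuous_on {0..1} u" and contp: "continuous_on {0..1} p"
    and contf: "continuous_on {0..1} f"
    using C1u f by (auto simp: C1_on01_def p_def differentiable_imp_continuous_on)
  obtain T where T: "\<tau> < T" "T \<le> 1" "u T = 0" and upos: "\<And>t. \<tau> \<le> t \<Longrightarrow> t < T \<Longrightarrow> 0 < u t"
  proof (rule first_zero_after[of \<tau> 1 u])
    show "continuous_on {\<tau>..1} u" using \<tau> by (intro continuous_on_subset[OF contu]) auto
  qed (use \<tau> u\<tau> u1 in auto)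
  have sub: "{\<tau>..T} \<subseteq> {0..1}" using \<tau> T by auto
  have "\<exists>t\<in>{\<tau>..T}. \<forall>t'\<in>{\<tau>..T}. u t' \<le> u t"
    using T by (intro continuous_attains_sup continuous_on_subset[OF contu sub]) auto
  then obtain tm where tm: "tm \<in> {\<tau>..T}" "\<And>t. t \<in> {\<tau>..T} \<Longrightarrow> u t \<le> u tm" by blast
  define M where "M = u tm"
  have x0M: "x0 \<le> M" and uM: "\<And>t. t \<in> {\<tau>..T} \<Longrightarrow> u t \<le> M"
    using tm T by (auto simp: M_def x0_def)
  have u0: "0 \<le> u t" if "t \<in> {\<tau>..T}" for t
    using that upos[of t] T by (cases "t = T") auto
  define H where "H t = (p t)\<^sup>2 / 2 + G (u t) - (lam + f t) * u t" for t
  \<comment> \<open>The friction term only dissipates, so \<open>H' \<le> - f' u \<le> F M\<close>, which the linear term compensates.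
    The singular point of the equation is at most an end point of the interval used here.\<close>
  have energy: "H t \<le> H \<tau> + F * M" if t: "t \<in> {\<tau>..T}" for t
  proof -
    have "H t - F * M * t \<le> H \<tau> - F * M * \<tau>"
    proof (rule DERIV_nonpos_imp_decreasing_open[of \<tau> t "\<lambda>t. H t - F * M * t"])
      fix r assume r: "\<tau> < r" "r < t"
      then have r01: "0 < r" "r < 1" and ur: "0 < u r" using t T \<tau> upos[of r] by auto
      have "p differentiable (at r within {0..1})"
        and ode: "- D01 p r - (real n - 1) / r * p r = g (u r) - lam - f r"
        using sol r01 by (auto simp: solves_bvp_def p_def)
      then have "(p has_real_derivative D01 p r) (at r within {0..1})"
        unfolding D01_def
        by (simp add: has_real_derivative_iff_has_vector_derivative vector_derivative_works[symmetric])
      then have dp: "(p has_real_derivative D01 p r) (at r)"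
        using r01 by (simp add: at_within_Icc_at)
      have du: "(u has_real_derivative p r) (at r)"
        unfolding p_def by (rule C1_on01_has_real_derivative_at[OF C1u r01])
      have df: "(f has_real_derivative D01 f r) (at r)"
        by (rule C1_on01_has_real_derivative_at[OF f r01])
      have dG: "((\<lambda>t. G (u t)) has_real_derivative g (u r) * p r) (at r)"
        unfolding G_def by (rule DERIV_chain2[OF integral_from_0_has_real_derivative[OF g ur] du])
      define y where "y = p r * D01 p r + g (u r) * p r
        - (D01 f r * u r + (lam + f r) * p r) - F * M"
      have "((\<lambda>t. H t - F * M * t) has_real_derivative y) (at r)"
        unfolding H_def y_def
        by (auto intro!: derivative_eq_intros dp du df dG simp: power2_eq_square)
      moreover have "y \<le> 0"
      proof -
        have "p r * D01 p r + g (u r) * p r - (lam + f r) * p r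
            = p r * (D01 p r + (g (u r) - lam - f r))" by (simp add: algebra_simps)
        also have "\<dots> = - ((real n - 1) / r * (p r)\<^sup>2)"
          unfolding ode[symmetric] by (simp add: power2_eq_square)
        finally have "y = - ((real n - 1) / r * (p r)\<^sup>2) + (- D01 f r) * u r - F * M"
          by (simp add: y_def algebra_simps)
        moreover have "0 \<le> (real n - 1) / r * (p r)\<^sup>2" using n r01 by simp
        moreover have "(- D01 f r) * u r \<le> F * M"
          using F[of r] r01 ur uM[of r] r t F0 by (intro mult_mono) auto
        ultimately show ?thesis by linarith
      qed
      ultimately show "\<exists>y. ((\<lambda>t. H t - F * M * t) has_real_derivative y) (at r) \<and> y \<le> 0" by blast
    next
      have subt: "{\<tau>..t} \<subseteq> {\<tau>..T}" using t by auto
      have "continuous_on {0..M} G" unfolding G_def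
        by (intro indefinite_integral_continuous_1 integrable_continuous_real continuous_on_subset[OF g]) auto
      then have "continuous_on {\<tau>..t} (\<lambda>t. G (u t))"
        by (rule continuous_on_compose2[OF _ continuous_on_subset[OF contu]])
          (use u0 uM subt sub in auto)
      then show "continuous_on {\<tau>..t} (\<lambda>t. H t - F * M * t)"
        unfolding H_def using subt sub
        by (intro continuous_intros continuous_on_subset[OF contu]
            continuous_on_subset[OF contp] continuous_on_subset[OF contf]) auto
    qed (use t in auto)
    moreover have "(F * M) * (t - \<tau>) \<le> (F * M) * 1"
      using t T \<tau> F0 u0[OF tm(1)] by (intro mult_left_mono) (auto simp: M_def)
    ultimately show ?thesis by (simp add: algebra_simps)
  qed
  have H\<tau>: "H \<tau> \<le> F\<^sup>2 / 2 + G x0 - g x0 * x0"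
  proof -
    have "(p \<tau>)\<^sup>2 \<le> F\<^sup>2" using flat by (simp add: p_def abs_le_square_iff[symmetric] F0)
    then show ?thesis using contact by (simp add: H_def x0_def)
  qed
  \<comment> \<open>At an excursion \<open>d = M - x0 \<ge> x0 \<ge> 1\<close> the potential would exceed the bottom of the well by
    \<open>s / 2 * d\<^sup>2\<close>, while the energy available is only of order \<open>F\<^sup>2 / 2 + 2 * F * M\<close>.\<close>
  have "M < 2 * x0"
  proof (rule ccontr)
    assume "\<not> ?thesis"
    define d where "d = M - x0"
    have d: "x0 \<le> d" "1 \<le> d" "M = x0 + d" using \<open>\<not> M < 2 * x0\<close> u\<tau> by (auto simp: d_def x0_def)
    have "G x0 + g x0 * d + s / 2 * d\<^sup>2 \<le> G M"
      unfolding G_def d_def using above x0M u\<tau> by (intro integral_above_tangent[OF g]) (auto simp: x0_def)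
    moreover have "\<bar>f tm - f \<tau>\<bar> \<le> F"
    proof -
      have "norm (f tm - f \<tau>) \<le> F * norm (tm - \<tau>)"
        using sub tm(1) T F \<tau>
        by (intro field_differentiable_bound[of "{0..1}" f "D01 f"] C1_on01_has_real_derivative[OF f]) auto
      also have "\<dots> \<le> F * 1" using tm(1) \<tau> T F0 by (intro mult_left_mono) auto
      finally show ?thesis by simp
    qed
    then have "(lam + f tm) * M \<le> (g x0 + F) * M"
      using contact u0[OF tm(1)] by (intro mult_right_mono) (auto simp: x0_def M_def)
    moreover have "0 \<le> (p tm)\<^sup>2 / 2" by simp
    moreover have "H tm \<le> H \<tau> + F * M" by (rule energy[OF tm(1)])
    moreover have "H tm = (p tm)\<^sup>2 / 2 + G M - (lam + f tm) * M" by (simp add: H_def M_def)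
    moreover have "g x0 * M = g x0 * x0 + g x0 * d" "(g x0 + F) * M = g x0 * M + F * M"
      using d by (auto simp: algebra_simps)
    ultimately have "s / 2 * d\<^sup>2 \<le> F\<^sup>2 / 2 + 2 * (F * M)" using H\<tau> by linarith
    also have "\<dots> \<le> (F\<^sup>2 / 2) * d\<^sup>2 + 2 * (F * (2 * d\<^sup>2))"
    proof -
      have dd: "d \<le> d\<^sup>2" "1 \<le> d\<^sup>2" using d by (simp_all add: self_le_power)
      then have "(F\<^sup>2 / 2) * 1 \<le> (F\<^sup>2 / 2) * d\<^sup>2" by (intro mult_left_mono) auto
      moreover have "F * M \<le> F * (2 * d\<^sup>2)" using dd d F0 by (intro mult_left_mono) auto
      ultimately show ?thesis by linarith
    qed
    finally have "s * d\<^sup>2 \<le> (F\<^sup>2 + 8 * F) * d\<^sup>2" by (simp add: algebra_simps)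
    moreover have "0 < d\<^sup>2" using d by simp
    ultimately show False using s by simp
  qed
  then have "F * M \<le> F * (2 * x0)" using F0 by (intro mult_left_mono) auto
  moreover have "0 \<le> H T" using T by (simp add: H_def G_def)
  moreover have "H T \<le> H \<tau> + F * M" using T by (intro energy) auto
  ultimately show ?thesis using H\<tau> by (simp add: x0_def G_def)
qed

section \<open>The curve of positive equilibria\<close>

text \<open>The tangent at \<open>y\<close> lies below the graph, so \<open>g' y\<close> is at most the slope of any secant from
  \<open>y\<close> to the right. Secant slopes are continuous in \<open>y\<close>, and those from \<open>x\<close> approach \<open>g' x\<close>; this
  gives upper semicontinuity, and secants to the left give lower semicontinuity. Continuity
  of \<open>g'\<close> makes the curve of equilibria \<open>C\<^sup>1\<close>, as the stability of the zero count requires.\<close>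

lemma convex_derivative_isCont:
  fixes g g' :: "real \<Rightarrow> real"
  assumes S: "open S" and conn: "connected S" and conv: "convex_on S g"
    and g': "\<And>x. x \<in> S \<Longrightarrow> (g has_real_derivative g' x) (at x)" and x: "x \<in> S"
  shows "isCont g' x"
proof -
  have tangent: "g' y * (z - y) \<le> g z - g y" if "y \<in> S" "z \<in> S" for y z
    using that S by (intro convex_on_imp_above_tangent[OF conv conn] has_field_derivative_at_within[OF g'])
      (auto simp: interior_open)
  have slope: "((\<lambda>z. (g z - g x) / (z - x)) \<longlongrightarrow> g' x) (at x)"
    using g'[OF x] by (simp add: has_field_derivative_iff)
  have nearS: "\<forall>\<^sub>F y in at x within A. y \<in> S" for A
    using S x by (metis eventually_at_topological)
  have secant: "((\<lambda>y. (g z - g y) / (z - y)) \<longlongrightarrow> (g z - g x) / (z - x)) (at x)" if "z \<noteq> x" for z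
    using that DERIV_isCont[OF g'[OF x]] by (intro tendsto_intros) (auto simp: isCont_def)
  have "(g' \<longlongrightarrow> g' x) (at x)"
  proof (rule order_tendstoI)
    fix c assume c: "g' x < c"
    have "\<forall>\<^sub>F z in at_right x. (g z - g x) / (z - x) < c"
      using order_tendstoD(2)[OF slope c] by (rule filter_leD[OF at_le, rotated]) simp
    then have "\<forall>\<^sub>F z in at_right x. (g z - g x) / (z - x) < c \<and> z \<in> S \<and> x < z"
      using nearS eventually_at_right_less by eventually_elim auto
    then obtain z where z: "(g z - g x) / (z - x) < c" "z \<in> S" "x < z"
      using eventually_happens'[OF trivial_limit_at_right_real] by blast
    have "\<forall>\<^sub>F y in at x. (g z - g y) / (z - y) < c"
      using order_tendstoD(2)[OF secant z(1)] z(3) by simp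
    moreover have "\<forall>\<^sub>F y in at x. y < z"
      using order_tendstoD(2)[OF tendsto_ident_at z(3)] .
    ultimately show "\<forall>\<^sub>F y in at x. g' y < c"
      using nearS[of UNIV]
    proof eventually_elim
      case (elim y)
      then have "g' y \<le> (g z - g y) / (z - y)"
        using tangent[of y z] z by (simp add: pos_le_divide_eq)
      then show ?case using elim by simp
    qed
  next
    fix c assume c: "c < g' x"
    have "\<forall>\<^sub>F z in at_left x. c < (g z - g x) / (z - x)"
      using order_tendstoD(1)[OF slope c] by (rule filter_leD[OF at_le, rotated]) simp
    moreover have "\<forall>\<^sub>F z in at_left x. z < x" by (simp add: eventually_at_filter)
    ultimately have "\<forall>\<^sub>F z in at_left x. c < (g z - g x) / (z - x) \<and> z \<in> S \<and> z < x"
      using nearS by eventually_elim auto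
    then obtain z where z: "c < (g z - g x) / (z - x)" "z \<in> S" "z < x"
      using eventually_happens'[OF trivial_limit_at_left_real] by blast
    have "\<forall>\<^sub>F y in at x. c < (g z - g y) / (z - y)"
      using order_tendstoD(1)[OF secant z(1)] z(3) by simp
    moreover have "\<forall>\<^sub>F y in at x. z < y"
      using order_tendstoD(1)[OF tendsto_ident_at z(3)] .
    ultimately show "\<forall>\<^sub>F y in at x. c < g' y"
      using nearS[of UNIV]
    proof eventually_elim
      case (elim y)
      then have "(g z - g y) / (z - y) \<le> g' y"
        using tangent[of y z] z by (simp add: neg_divide_le_eq)
      then show ?case using elim by simp
    qed
  qed
  then show ?thesis by (simp add: isCont_def)
qed

lemma superlinear_ge_linear:
  fixes g :: "real \<Rightarrow> real"
  assumes "filterlim (\<lambda>x. g x / x) at_top at_top"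
  obtains X where "b \<le> X" "1 \<le> X" "\<And>x. X \<le> x \<Longrightarrow> N * x \<le> g x"
proof -
  have "\<forall>\<^sub>F x in at_top. N \<le> g x / x" using assms by (simp add: filterlim_at_top)
  then obtain Y where Y: "\<And>x. Y \<le> x \<Longrightarrow> N \<le> g x / x" by (auto simp: eventually_at_top_linorder)
  show ?thesis
  proof (rule that[of "max Y (max b 1)"])
    fix x assume "max Y (max b 1) \<le> x"
    then show "N * x \<le> g x" using Y[of x] by (simp add: pos_le_divide_eq)
  qed auto
qed

lemma g_plus_inv_works:
  assumes g: "continuous_on UNIV g" and mono: "strict_mono_on {A..} g"
    and lim: "filterlim (\<lambda>x. g x / x) at_top at_top" and y: "g A \<le> y"
  shows "A \<le> g_plus_inv g A y" "g (g_plus_inv g A y) = y"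
proof -
  obtain X where X: "max A \<bar>y\<bar> \<le> X" "1 \<le> X" "\<And>x. X \<le> x \<Longrightarrow> 1 * x \<le> g x"
    using superlinear_ge_linear[OF lim, of "max A \<bar>y\<bar>" 1] by blast
  then have "y \<le> g X" using X(1) X(3)[of X] by linarith
  then have "\<exists>x. A \<le> x \<and> x \<le> X \<and> g x = y"
    using X y by (intro IVT' continuous_on_subset[OF g]) auto
  then have "y \<in> g ` {A..}" by auto
  moreover have "inj_on g {A..}" using mono by (rule strict_mono_on_imp_inj_on)
  ultimately show "A \<le> g_plus_inv g A y" "g (g_plus_inv g A y) = y"
    using the_inv_into_into[of g "{A..}" y "{A..}"] f_the_inv_into_f[of g "{A..}" y]
    by (auto simp: g_plus_inv_def)
qed

lemma g_plus_inv_greater: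
  assumes "continuous_on UNIV g" "strict_mono_on {A..} g"
    "filterlim (\<lambda>x. g x / x) at_top at_top" and x: "A \<le> x" "g x < y"
  shows "x < g_plus_inv g A y"
proof -
  have "g A \<le> g x" using x(1) strict_mono_onD[OF assms(2), of A x] by (cases "A = x") auto
  then have "A \<le> g_plus_inv g A y" "g (g_plus_inv g A y) = y"
    using g_plus_inv_works[OF assms(1-3), of y] x by auto
  then show ?thesis
    using x strict_mono_onD[OF assms(2), of "g_plus_inv g A y" x]
    by (cases "g_plus_inv g A y" x rule: linorder_cases) auto
qed

lemma g_plus_inv_has_real_derivative:
  assumes g: "continuous_on UNIV g" and mono: "strict_mono_on {A..} g"
    and lim: "filterlim (\<lambda>x. g x / x) at_top at_top" and y: "g A < y"
    and d: "(g has_real_derivative d) (at (g_plus_inv g A y))" "d \<noteq> 0"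
  shows "(g_plus_inv g A has_real_derivative inverse d) (at y)"
proof -
  define x where "x = g_plus_inv g A y"
  have x: "A < x" "g x = y"
    using g_plus_inv_greater[OF g mono lim _ y] g_plus_inv_works[OF g mono lim, of y] y
    by (auto simp: x_def)
  have "isCont (g_plus_inv g A) (g x)"
  proof (rule isCont_inverse_function[where f = g and x = x and d = "x - A"])
    fix z assume z: "\<bar>z - x\<bar> \<le> x - A"
    show "g_plus_inv g A (g z) = z"
      unfolding g_plus_inv_def using z
      by (intro the_inv_into_f_f strict_mono_on_imp_inj_on[OF mono]) auto
    show "isCont g z" using g by (simp add: continuous_on_eq_continuous_at)
  qed (use x in auto)
  then have cont: "isCont (g_plus_inv g A) y" using x by simp
  show ?thesis
    by (rule DERIV_inverse_function[where f = g and g = "g_plus_inv g A" and x = y and a = "g A" and b = "y + 1"])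
      (use g_plus_inv_works[OF g mono lim] d y cont in auto)
qed


lemma DERIV_deriv_of_differentiable_on:
  fixes g :: "real \<Rightarrow> real"
  assumes "g differentiable_on {A..}" "A < x"
  shows "(g has_real_derivative deriv g x) (at x)"
proof -
  have "g differentiable (at x within {A..})" using assms by (simp add: differentiable_on_def)
  then have "g differentiable (at x)"
    using assms(2) at_within_interior[of x "{A..}"] by simp
  then show ?thesis by (simp add: DERIV_deriv_iff_real_differentiable)
qed

lemma convex_tangent_above:
  fixes g :: "real \<Rightarrow> real"
  assumes "g differentiable_on {A..}" "convex_on {A..} g" "A < y" "A \<le> x"
  shows "deriv g y * (x - y) \<le> g x - g y"
  using assms
  by (intro convex_on_imp_above_tangent[OF assms(2)]
      has_field_derivative_at_within[OF DERIV_deriv_of_differentiable_on[OF assms(1)]]) auto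

lemma convex_increasing_deriv_pos:
  fixes g :: "real \<Rightarrow> real"
  assumes "strict_mono_on {A..} g" "g differentiable_on {A..}" "convex_on {A..} g" "A < x"
  shows "0 < deriv g x"
proof -
  have "deriv g x * (A - x) \<le> g A - g x" using assms by (intro convex_tangent_above) auto
  moreover have "g A < g x" using assms by (intro strict_mono_onD[OF assms(1)]) auto
  ultimately have "deriv g x * (A - x) < 0" by linarith
  then show ?thesis using assms(4) by (simp add: mult_less_0_iff)
qed

lemma
  fixes f g :: "real \<Rightarrow> real"
  assumes f: "C1_on01 f" and g: "continuous_on UNIV g" and mono: "strict_mono_on {A..} g"
    and diff: "g differentiable_on {A..}" and conv: "convex_on {A..} g"
    and lim: "filterlim (\<lambda>x. g x / x) at_top at_top"
    and large: "\<And>t. t \<in> {0..1} \<Longrightarrow> g A < lam + f t"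
  defines "\<phi> \<equiv> \<lambda>t. g_plus_inv g A (lam + f t)"
  shows C1_equilibrium_branch_deriv: "\<And>t. t \<in> {0..1} \<Longrightarrow>
      (\<phi> has_real_derivative inverse (deriv g (\<phi> t)) * D01 f t) (at t within {0..1})"
    and C1_equilibrium_branch_cont: "continuous_on {0..1} (\<lambda>t. inverse (deriv g (\<phi> t)) * D01 f t)"
proof -
  have \<phi>: "A < \<phi> t" if "t \<in> {0..1}" for t
    unfolding \<phi>_def using large[OF that] by (intro g_plus_inv_greater[OF g mono lim]) auto
  have pos: "0 < deriv g (\<phi> t)" if "t \<in> {0..1}" for t
    using \<phi>[OF that] by (rule convex_increasing_deriv_pos[OF mono diff conv])
  show deriv: "(\<phi> has_real_derivative inverse (deriv g (\<phi> t)) * D01 f t) (at t within {0..1})"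
    if t: "t \<in> {0..1}" for t
  proof -
    have "(g_plus_inv g A has_real_derivative inverse (deriv g (\<phi> t))) (at (lam + f t))"
      using pos[OF t] \<phi>[OF t] large[OF t] DERIV_deriv_of_differentiable_on[OF diff, of "\<phi> t"]
      by (intro g_plus_inv_has_real_derivative[OF g mono lim]) (auto simp: \<phi>_def)
    moreover have "((\<lambda>t. lam + f t) has_real_derivative D01 f t) (at t within {0..1})"
      using C1_on01_has_real_derivative[OF f t] by (auto intro!: derivative_eq_intros)
    ultimately show ?thesis unfolding \<phi>_def by (rule DERIV_chain2)
  qed
  have cont\<phi>: "continuous_on {0..1} \<phi>"
    by (rule DERIV_continuous_on) (rule deriv)
  have "isCont (deriv g) x" if "A < x" for x
  proof (rule convex_derivative_isCont[of "{A<..}" g])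
    show "convex_on {A<..} g" by (rule convex_on_subset[OF conv]) auto
    show "(g has_real_derivative deriv g x) (at x)" if "x \<in> {A<..}" for x
      using that by (intro DERIV_deriv_of_differentiable_on[OF diff]) auto
  qed (use that in auto)
  then have "continuous_on {A<..} (deriv g)" by (simp add: continuous_at_imp_continuous_on)
  then have "continuous_on {0..1} (\<lambda>t. deriv g (\<phi> t))"
    by (rule continuous_on_compose2[OF _ cont\<phi>]) (use \<phi> in auto)
  then show "continuous_on {0..1} (\<lambda>t. inverse (deriv g (\<phi> t)) * D01 f t)"
    using f pos by (intro continuous_intros) (auto simp: C1_on01_def less_le)
qed

section \<open>Solutions on the frontier for large \<open>lam\<close>\<close>

theorem proposition3:
  fixes n :: nat and f g :: "real \<Rightarrow> real" and A :: real
  assumes "n \<ge> 1"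
    and "C1_on01 f"
    and "continuous_on UNIV g"
    and "A > 0"
    and "\<forall>x\<in>{A..}. g x > 0" and "strict_mono_on {A..} g"
    and "g differentiable_on {A..}" and "convex_on {A..} g"
    and "\<forall>x\<in>{..-A}. g x > 0" and "convex_on {..-A} g"
    and "antimono_on {..-A} g"
    and "filterlim (\<lambda>x. g x / x) at_top at_top"
    and "filterlim (\<lambda>x. g x / x) at_bot at_bot"
  shows "\<exists>B :: nat \<Rightarrow> real. (\<forall>k. B k > 0) \<and>
    (\<forall>k. \<forall>lam > B k. Z_defined g f A lam \<and>
      \<not> (\<exists>u \<in> E_top frontier_of Z_set g f A (2 * k) lam.
            solves_bvp n g f lam u \<and> local_min_at_0 u \<and> D01 u 0 \<le> 0))"
proof -
  note f = assms(2) and g = assms(3) and A = assms(4) and mono = assms(6)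
    and diff = assms(7) and conv = assms(8) and lim = assms(12)
  have "compact (f ` {0..1})" "compact (D01 f ` {0..1})"
    using f by (auto simp: C1_on01_def intro!: compact_continuous_image differentiable_imp_continuous_on)
  then obtain S F where S: "\<And>t. t \<in> {0..1} \<Longrightarrow> \<bar>f t\<bar> \<le> S"
    and F: "\<And>t. t \<in> {0..1} \<Longrightarrow> \<bar>D01 f t\<bar> \<le> F"
    by (fastforce dest!: compact_imp_bounded simp: bounded_iff)
  have F0: "0 \<le> F" and S0: "0 \<le> S" using F[of 0] S[of 0] by auto
  define G where "G = integral {0..A} g"
  \<comment> \<open>\<open>N\<close> is a growth rate large enough to make the slope of \<open>g\<close> beat \<open>F\<^sup>2 + 8 * F\<close> and the depth
    of the potential well, which is at least \<open>A * g x0 - G\<close>, beat \<open>F\<^sup>2 / 2 + 2 * F * x0\<close>.\<close>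
  define N where "N = max (F\<^sup>2 + 8 * F + 1 + \<bar>g A\<bar>) ((\<bar>G\<bar> + F\<^sup>2 / 2 + 2 * F + 1) / A)"
  obtain X where X: "A + 1 \<le> X" "1 \<le> X" and lin: "\<And>x. X \<le> x \<Longrightarrow> N * x \<le> g x"
    using superlinear_ge_linear[OF lim, of "A + 1" N] by blast
  have N: "F\<^sup>2 + 8 * F + 1 + \<bar>g A\<bar> \<le> N" "\<bar>G\<bar> + F\<^sup>2 / 2 + 2 * F + 1 \<le> A * N"
  proof -
    have "(\<bar>G\<bar> + F\<^sup>2 / 2 + 2 * F + 1) / A \<le> N" by (simp add: N_def)
    then show "\<bar>G\<bar> + F\<^sup>2 / 2 + 2 * F + 1 \<le> A * N"
      using A by (simp only: pos_divide_le_eq mult.commute)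
  qed (simp add: N_def)
  define B where "B = \<bar>g X\<bar> + S + A + 1"
  have "Z_defined g f A lam \<and>
      \<not> (\<exists>u \<in> E_top frontier_of Z_set g f A (2 * k) lam.
            solves_bvp n g f lam u \<and> local_min_at_0 u \<and> D01 u 0 \<le> 0)" if lam: "B < lam" for lam k
  proof -
    have gAX: "g A < g X" using X by (intro strict_mono_onD[OF mono]) auto
    have large: "g X < lam + f t" if "t \<in> {0..1}" for t
      using lam S[OF that] A by (simp add: B_def)
    define \<phi> where "\<phi> t = g_plus_inv g A (lam + f t)" for t
    have largeA: "g A < lam + f t" if "t \<in> {0..1}" for t
      using large[OF that] gAX by simp
    have \<phi>X: "X < \<phi> t" if "t \<in> {0..1}" for t
      unfolding \<phi>_def using X large[OF that] by (intro g_plus_inv_greater[OF g mono lim]) auto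
    have g\<phi>: "g (\<phi> t) = lam + f t" if "t \<in> {0..1}" for t
      unfolding \<phi>_def using largeA[OF that] by (intro g_plus_inv_works[OF g mono lim]) auto
    have "Z_defined g f A lam"
      using lam S0 by (auto simp: Z_defined_def B_def intro!: less_imp_le[OF largeA])
    moreover have False if u: "u \<in> E_top frontier_of Z_set g f A (2 * k) lam"
      and sol: "solves_bvp n g f lam u" for u
    proof -
      obtain \<tau> where \<tau>: "\<tau> \<in> {0..1}" "u \<tau> = \<phi> \<tau>"
        and slope: "\<tau> = 0 \<or> D01 u \<tau> = inverse (deriv g (\<phi> \<tau>)) * D01 f \<tau>"
      proof (rule frontier_simple_zeros_contact)
        show "(\<phi> has_real_derivative inverse (deriv g (\<phi> t)) * D01 f t) (at t within {0..1})"
          if "t \<in> {0..1}" for t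
          unfolding \<phi>_def using that
          by (intro C1_equilibrium_branch_deriv[OF f g mono diff conv lim largeA])
        show "continuous_on {0..1} (\<lambda>t. inverse (deriv g (\<phi> t)) * D01 f t)"
          unfolding \<phi>_def
          by (intro C1_equilibrium_branch_cont[OF f g mono diff conv lim largeA])
        show "\<phi> 1 \<noteq> 0" using \<phi>X[of 1] X by auto
        show "u \<in> E_top frontier_of {u \<in> E_set. has_simple_zeros (2 * k) (\<lambda>t. u t - \<phi> t)}"
          using u by (simp add: Z_set_def \<phi>_def)
      qed
      define x0 where "x0 = \<phi> \<tau>"
      define s where "s = deriv g x0"
      have x0: "X < x0" using \<phi>X[OF \<tau>(1)] by (simp add: x0_def)
      have gx0: "N * x0 \<le> g x0" using lin x0 by simp
      have "g x0 - g A \<le> s * (x0 - A)"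
        using convex_tangent_above[OF diff conv, of x0 A] x0 X by (simp add: s_def algebra_simps)
      moreover have "\<bar>g A\<bar> * 1 \<le> \<bar>g A\<bar> * x0" using x0 X by (intro mult_left_mono) auto
      moreover have "(F\<^sup>2 + 8 * F + 1 + \<bar>g A\<bar>) * x0 \<le> N * x0"
        using N x0 X by (intro mult_right_mono) auto
      moreover have "0 \<le> (F\<^sup>2 + 8 * F + 1) * A" using F0 A by simp
      ultimately have "(F\<^sup>2 + 8 * F + 1) * (x0 - A) \<le> s * (x0 - A)"
        using gx0 by (simp add: algebra_simps)
      then have s: "F\<^sup>2 + 8 * F + 1 \<le> s" using x0 X by simp
      \<comment> \<open>The equilibrium branch varies slowly: its slope is \<open>f' / s\<close> with \<open>s \<ge> 1\<close>.\<close>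
      have flat: "\<bar>D01 u \<tau>\<bar> \<le> F"
      proof (cases "\<tau> = 0")
        case True
        then show ?thesis using sol F0 by (simp add: solves_bvp_def)
      next
        case False
        have "1 \<le> s" using s F0 by (smt (verit) zero_le_power2)
        have "\<bar>D01 u \<tau>\<bar> = \<bar>D01 f \<tau>\<bar> / s"
          using False slope \<open>1 \<le> s\<close> by (simp add: s_def x0_def abs_mult divide_inverse)
        also have "\<dots> \<le> \<bar>D01 f \<tau>\<bar> / 1"
          using \<open>1 \<le> s\<close> by (intro divide_left_mono) auto
        finally show ?thesis using F[OF \<tau>(1)] by simp
      qed
      have "g (u \<tau>) * u \<tau> - integral {0..u \<tau>} g \<le> F\<^sup>2 / 2 + 2 * F * u \<tau>"
      proof (rule solution_energy_bound_at_contact[OF assms(1) f g sol F \<tau>(1)])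
        show "g (u \<tau>) = lam + f \<tau>" using \<tau> g\<phi> by simp
        show "1 \<le> u \<tau>" using \<tau> x0 X by (simp add: x0_def)
        show "F\<^sup>2 + 8 * F < s" using s by simp
        show "g (u \<tau>) + s * (x - u \<tau>) \<le> g x" if "u \<tau> \<le> x" for x
          using convex_tangent_above[OF diff conv, of "u \<tau>" x] that \<tau> x0 X
          by (simp add: s_def x0_def)
      qed (use flat in simp_all)
      then have "g x0 * x0 - integral {0..x0} g \<le> F\<^sup>2 / 2 + 2 * F * x0"
        using \<tau> by (simp add: x0_def)
      moreover have "integral {0..x0} g \<le> G + g x0 * (x0 - A)"
        unfolding G_def
      proof (rule integral_le_of_increasing[OF g A])
        show "g x \<le> g x0" if "A \<le> x" "x \<le> x0" for x
          using that strict_mono_onD[OF mono, of x x0] by (cases "x = x0") auto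
      qed (use x0 X in auto)
      moreover have "(\<bar>G\<bar> + F\<^sup>2 / 2 + 2 * F + 1) * x0 \<le> A * g x0"
      proof -
        have "(\<bar>G\<bar> + F\<^sup>2 / 2 + 2 * F + 1) * x0 \<le> (A * N) * x0"
          using N x0 X by (intro mult_right_mono) auto
        also have "\<dots> \<le> A * g x0"
          using gx0 A by (simp add: mult.assoc)
        finally show ?thesis .
      qed
      moreover have "(\<bar>G\<bar> + F\<^sup>2 / 2 + 1) * 1 \<le> (\<bar>G\<bar> + F\<^sup>2 / 2 + 1) * x0"
        using x0 X by (intro mult_left_mono) auto
      ultimately show False
        by (simp add: algebra_simps)
    qed
    ultimately show ?thesis by blast
  qed
  moreover have "0 < B" using S0 A by (simp add: B_def)
  ultimately show ?thesis by (intro exI[of _ "\<lambda>_. B"]) auto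
qed

end
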